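(* Let $1<\beta<2$, and let $\rho:(0,\infty)\to(0,\infty)$ be a positive function such that $\lim_{x\to\infty}\rho(x)=0$. Then there exist functions $f$ and $F$ holomorphic in $\mathbb{C}_+$ and continuous in $\overline{\mathbb{C}_+}$, and constants $c,C>0$, such that (1) $f(x+iy)\neq 0$ and $F(x+iy)\neq 0$ for all $x\in\mathbb{R}$, $0<y<1$; (2) $|f(x+iy)|\le c\exp(Cy^{\beta})$ for all $x+iy\in\overline{\mathbb{C}_+}$ ($x\in\mathbb{R}$, $y\ge 0$); (3) $|F(z)|\le c\exp(C|z|^{\beta})$ for all $z\in\overline{\mathbb{C}_+}$, and $|F(x)|=1$ for all $x\in\mathbb{R}$; (4) $$\liminf_{x\to+\infty}\frac{\log|f(x+i/2)|}{\rho(x)\,x^{\beta+1}}<0,\qquad \liminf_{x\to+\infty}\frac{\log|F(x+i/2)|}{\rho(x)\,x^{\beta+1}}<0.$$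
   Context: $\mathbb{C}_+=\{z\in\mathbb{C}:\mathrm{Im}\, z>0\}$ is the open upper half-plane and $\overline{\mathbb{C}_+}=\{z\in\mathbb{C}:\mathrm{Im}\, z\ge 0\}$. The liminf's are allowed to be $-\infty$. *)

theory Defs
  imports "HOL-Complex_Analysis.Complex_Analysis"
begin

definition upper_half_plane :: "complex set" where
  "upper_half_plane = {z. Im z > 0}"

definition closed_upper_half_plane :: "complex set" where
  "closed_upper_half_plane = {z. Im z \<ge> 0}"

end

theory Submission
  imports Defs
begin

text \<open>
  The zeros are taken at points \<open>a\<^sub>k = x\<^sub>k + \<i>\<close> of the line \<open>Im z = 1\<close>, where \<open>x\<^sub>k\<close> tends to
  infinity very fast, with multiplicities \<open>m\<^sub>k\<close> of size about \<open>\<rho>(x\<^sub>k) x\<^sub>k powr (\<beta> + 1)\<close>. The function \<open>F\<close> is the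
  product of the \<open>m\<^sub>k\<close>-th powers of the Nevanlinna factors of genus one,

  \<open>b(a, z) = (1 - z/a) exp(z/a) / ((1 - z/cnj a) exp(z/cnj a))\<close>,

  which are unimodular on the real axis and vanish in the upper half-plane only at \<open>a\<close>. In the
  closed upper half-plane, \<open>ln \<bar>b(a, z)\<bar> \<le> 4 Im a \<bar>z\<bar> powr \<beta> / \<bar>a\<bar> powr (\<beta> + 1)\<close>
  (\<open>norm_nevanlinna_factor_le_powr\<close>): for \<open>\<bar>z\<bar> \<le> \<bar>a\<bar>/2\<close> because \<open>b(a, z)\<close> is the exponential of a
  quantity of size at most \<open>4 Im a \<bar>z\<bar>\<^sup>2 / \<bar>a\<bar>\<^sup>3\<close> (\<open>nevanlinna_factor_log\<close>) and \<open>\<beta> < 2\<close>, and for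
  larger \<open>z\<close> because \<open>\<bar>b(a, z)\<bar>\<close> is at most the modulus of its exponential part and \<open>\<beta> > 1\<close>. Hence
  the product converges and satisfies \<open>\<bar>F(z)\<bar> \<le> exp(C \<bar>z\<bar> powr \<beta>)\<close> as soon as
  \<open>\<Sum>\<^sub>k m\<^sub>k Im a\<^sub>k / \<bar>a\<^sub>k\<bar> powr (\<beta> + 1)\<close> is finite. Since \<open>\<rho>\<close> tends to \<open>0\<close>, the \<open>x\<^sub>k\<close> can be chosen
  so sparse that this holds.

  The \<open>x\<^sub>k\<close> are at least \<open>2\<close>. At \<open>x\<^sub>k + \<i>/2\<close> the factor of the zero \<open>a\<^sub>k\<close> has modulus at most
  \<open>exp(-1/2)\<close>, so that its \<open>m\<^sub>k\<close>-th power contributes at most \<open>-m\<^sub>k/2\<close> to \<open>ln \<bar>F\<bar>\<close>. The other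
  factors contribute at most \<open>O(x\<^sub>k powr \<beta>)\<close>, which is of lower order once \<open>\<rho>(x)\<close> has been enlarged
  to \<open>\<rho>(x) + 1/sqrt x\<close> in the choice of \<open>m\<^sub>k\<close>.

  Finally \<open>f(z) = F(z) exp(A (-\<i> z) powr \<beta>)\<close>. In a narrow sector along
  the real axis, \<open>(-\<i> z) powr \<beta>\<close> has polar angle close to \<open>\<plusminus>\<beta> \<pi>/2\<close>, whose cosine is negative because
  \<open>1 < \<beta> < 2\<close>; outside such a sector \<open>\<bar>z\<bar>\<close> is comparable to \<open>Im z\<close>. This gives
  \<open>Re ((-\<i> z) powr \<beta>) \<le> B (Im z) powr \<beta> - \<kappa> \<bar>z\<bar> powr \<beta>\<close> with \<open>\<kappa> > 0\<close>
  (\<open>Re_powr_le_right_half_plane\<close>), so a suitable \<open>A\<close> turns the bound in \<open>\<bar>z\<bar>\<close> into one in \<open>Im z\<close>.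
  On \<open>Im z = 1/2\<close> the additional factor is bounded, so the smallness of \<open>F\<close> carries over to \<open>f\<close>.
\<close>

section \<open>Nevanlinna factors of genus one\<close>

text \<open>
  The Nevanlinna factor of genus one with zero \<open>a\<close> and pole \<open>cnj a\<close>, the half-plane analogue of the
  Weierstrass elementary factor. At the pole, division by zero gives it the value \<open>0\<close>.
\<close>

definition nevanlinna_factor :: "complex \<Rightarrow> complex \<Rightarrow> complex" where
  "nevanlinna_factor a z = weierstrass_factor 1 (z / a) / weierstrass_factor 1 (z / cnj a)"

lemma nevanlinna_factor_holomorphic:
  assumes "Im a > 0"
  shows "nevanlinna_factor a holomorphic_on {z. Im z > - Im a}"
  using assms unfolding nevanlinna_factor_def
  by (intro holomorphic_intros) (auto simp: divide_eq_1_iff)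

lemma norm_nevanlinna_factor:
  assumes "a \<noteq> 0"
  shows "norm (nevanlinna_factor a z) =
    norm (z - a) / norm (z - cnj a) * exp (2 * Im z * Im a / (norm a)\<^sup>2)"
proof -
  have wf: "norm (weierstrass_factor 1 (z / b)) = norm (z - b) / norm b * exp (Re (z / b))"
    if "b \<noteq> 0" for b
  proof -
    have "1 - z / b = (b - z) / b"
      using that by (simp add: field_simps)
    then show ?thesis
      by (simp add: weierstrass_factor_def norm_mult norm_divide norm_minus_commute)
  qed
  have "Re (z / a) - Re (z / cnj a) = 2 * Im z * Im a / (norm a)\<^sup>2"
    by (simp add: Re_divide cmod_power2 diff_divide_distrib[symmetric] add_divide_distrib[symmetric])
  then have "exp (2 * Im z * Im a / (norm a)\<^sup>2) = exp (Re (z / a)) / exp (Re (z / cnj a))"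
    by (simp add: exp_diff[symmetric])
  then show ?thesis
    using assms wf[of a] wf[of "cnj a"] by (simp add: nevanlinna_factor_def norm_divide)
qed

lemma norm_nevanlinna_factor_real:
  assumes "Im a \<noteq> 0"
  shows "norm (nevanlinna_factor a (of_real t)) = 1"
proof -
  have "a \<noteq> 0"
    using assms by auto
  have "norm (of_real t - cnj a) = norm (cnj (of_real t - a))"
    by simp
  also have "\<dots> = norm (of_real t - a)"
    by (rule complex_mod_cnj)
  finally have "norm (of_real t - cnj a) = norm (of_real t - a)" .
  moreover have "of_real t \<noteq> a"
    using assms by auto
  ultimately show ?thesis
    using \<open>a \<noteq> 0\<close> by (simp add: norm_nevanlinna_factor)
qed

lemma nevanlinna_factor_eq_0_iff:
  assumes "Im a > 0" "Im z > - Im a"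
  shows "nevanlinna_factor a z = 0 \<longleftrightarrow> z = a"
  using assms by (auto simp: nevanlinna_factor_def divide_eq_1_iff)

lemma norm_nevanlinna_factor_le:
  assumes "Im a > 0" "Im z \<ge> 0"
  shows "norm (nevanlinna_factor a z) \<le> exp (2 * Im z * Im a / (norm a)\<^sup>2)"
proof -
  have "norm (z - a) \<le> norm (z - cnj a)"
    unfolding cmod_def using assms
    by (intro real_sqrt_le_mono add_mono) (auto simp: power2_eq_square algebra_simps)
  then have "norm (z - a) / norm (z - cnj a) \<le> 1"
    by (cases "norm (z - cnj a) = 0") auto
  then show ?thesis
    using assms mult_right_mono[OF _ exp_ge_zero, of _ 1 "2 * Im z * Im a / (norm a)\<^sup>2"]
    by (subst norm_nevanlinna_factor) (auto simp del: times_divide_eq_left)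
qed

text \<open>
  Where both \<open>z / a\<close> and \<open>z / cnj a\<close> are at most \<open>1/2\<close> in modulus, a logarithm of the factor is a
  difference of values of \<open>w \<mapsto> Ln (1 - w) + w\<close>, whose derivative is \<open>O(\<bar>w\<bar>)\<close>. The gain of
  \<open>Im a / \<bar>a\<bar>\<close> over the individual values comes from \<open>\<bar>1 / a - 1 / cnj a\<bar> = 2 Im a / \<bar>a\<bar>\<^sup>2\<close>.
\<close>

lemma nevanlinna_factor_log:
  assumes "Im a > 0" "norm z \<le> norm a / 2"
  obtains L where "nevanlinna_factor a z = exp L" "norm L \<le> 4 * Im a * (norm z)\<^sup>2 / norm a ^ 3"
proof -
  let ?g = "\<lambda>w. Ln (1 - w) + w"
  define r where "r = norm z / norm a"
  have a: "a \<noteq> 0" "norm a > 0"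
    using assms by auto
  have r: "0 \<le> r" "r \<le> 1/2"
    using assms a by (auto simp: r_def field_simps)
  have u: "z / a \<in> cball 0 r" and v: "z / cnj a \<in> cball 0 r"
    by (auto simp: r_def norm_divide)
  have ne: "w \<noteq> 1" if "w \<in> cball 0 r" for w :: complex
    using that r by auto
  have wf: "weierstrass_factor 1 w = exp (?g w)" if "w \<in> cball 0 r" for w
    using ne[OF that] by (simp add: weierstrass_factor_def exp_add)
  have "norm (?g (z / a) - ?g (z / cnj a)) \<le> (2 * r) * norm (z / a - z / cnj a)"
  proof (rule field_differentiable_bound[OF convex_cball _ _ u v])
    fix w :: complex assume w: "w \<in> cball 0 r"
    have nr: "norm w \<le> r"
      using w by simp
    have "1 - w \<notin> \<real>\<^sub>\<le>\<^sub>0"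
    proof
      assume "1 - w \<in> \<real>\<^sub>\<le>\<^sub>0"
      then have "Re w \<ge> 1"
        by (auto simp: complex_nonpos_Reals_iff)
      then show False
        using complex_Re_le_cmod[of w] nr r by linarith
    qed
    then show "(?g has_field_derivative (- w / (1 - w))) (at w within cball 0 r)"
      using ne[OF w] by (auto intro!: derivative_eq_intros simp: field_simps)
    have "1/2 \<le> norm (1 - w)"
      using norm_triangle_ineq2[of 1 w] nr r by simp
    then have "norm w / norm (1 - w) \<le> r / (1/2)"
      using nr r by (intro frac_le) auto
    then show "norm (- w / (1 - w)) \<le> 2 * r"
      by (simp add: norm_divide)
  qed
  also have "norm (z / a - z / cnj a) = norm z * (2 * Im a) / (norm a)\<^sup>2"
  proof -
    have "z / a - z / cnj a = z * (cnj a - a) / (a * cnj a)"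
      using a by (simp add: field_simps)
    moreover have "norm (cnj a - a) = 2 * Im a"
      using assms by (simp add: norm_minus_commute[of "cnj a"] complex_diff_cnj norm_mult)
    ultimately show ?thesis
      by (simp add: norm_mult norm_divide power2_eq_square)
  qed
  finally have "norm (?g (z / a) - ?g (z / cnj a)) \<le> 4 * Im a * (norm z)\<^sup>2 / norm a ^ 3"
    by (simp add: r_def power2_eq_square power3_eq_cube mult_ac)
  moreover have "nevanlinna_factor a z = exp (?g (z / a) - ?g (z / cnj a))"
    unfolding nevanlinna_factor_def wf[OF u] wf[OF v] exp_diff ..
  ultimately show ?thesis
    using that by blast
qed

lemma norm_nevanlinna_factor_le_powr:
  assumes "Im a > 0" "Im z \<ge> 0" "1 < \<beta>" "\<beta> < 2"
  shows "norm (nevanlinna_factor a z) \<le> exp (4 * (Im a / norm a powr (\<beta> + 1)) * norm z powr \<beta>)"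
proof -
  define R where "R = norm a"
  have R: "R > 0"
    using assms by (auto simp: R_def)
  show ?thesis
  proof (cases "norm z \<le> R / 2")
    case True
    obtain L where L: "nevanlinna_factor a z = exp L"
      "norm L \<le> 4 * Im a * (norm z)\<^sup>2 / R ^ 3"
      using nevanlinna_factor_log[OF assms(1), of z] True by (auto simp: R_def)
    have "(norm z)\<^sup>2 * R powr (\<beta> + 1) \<le> norm z powr \<beta> * R ^ 3"
    proof (cases "z = 0")
      case False
      have "(norm z)\<^sup>2 * R powr (\<beta> + 1) = norm z powr \<beta> * norm z powr (2 - \<beta>) * R powr (\<beta> + 1)"
        using False by (simp add: powr_add[symmetric])
      also have "\<dots> \<le> norm z powr \<beta> * R powr (2 - \<beta>) * R powr (\<beta> + 1)"
        using True R assms by (intro mult_left_mono mult_right_mono powr_mono2) auto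
      also have "\<dots> = norm z powr \<beta> * R ^ 3"
        using R by (simp add: mult.assoc powr_add[symmetric])
      finally show ?thesis .
    qed auto
    then have "(norm z)\<^sup>2 / R ^ 3 \<le> norm z powr \<beta> / R powr (\<beta> + 1)"
      using R by (simp add: divide_simps)
    then have "4 * Im a * ((norm z)\<^sup>2 / R ^ 3) \<le> 4 * Im a * (norm z powr \<beta> / R powr (\<beta> + 1))"
      using assms by (intro mult_left_mono) auto
    then have "norm L \<le> 4 * (Im a / R powr (\<beta> + 1)) * norm z powr \<beta>"
      using L(2) by simp
    then show ?thesis
      unfolding L(1) R_def[symmetric] using norm_exp[of L] order_trans exp_le_cancel_iff by blast
  next
    case False
    have z: "norm z > 0"
      using False R by auto
    \<comment> \<open>Here \<open>R < 2 * norm z\<close>, and the exponential part of the factor alone gives the bound.\<close>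
    have "norm z * R powr (\<beta> + 1) = norm z * R powr (\<beta> - 1) * R\<^sup>2"
      using R powr_add[of R "\<beta> - 1" 2] by (simp add: mult.assoc add.commute)
    also have "\<dots> \<le> norm z * (2 * norm z) powr (\<beta> - 1) * R\<^sup>2"
      using False R assms by (intro mult_right_mono mult_left_mono powr_mono2) auto
    also have "\<dots> = 2 powr (\<beta> - 1) * norm z powr \<beta> * R\<^sup>2"
      using z powr_add[of "norm z" 1 "\<beta> - 1"] by (simp add: powr_mult)
    also have "\<dots> \<le> 2 powr 1 * norm z powr \<beta> * R\<^sup>2"
      using assms by (intro mult_right_mono powr_mono) auto
    finally have "norm z / R\<^sup>2 \<le> 2 * norm z powr \<beta> / R powr (\<beta> + 1)"
      using R by (simp add: divide_simps)
    then have "2 * Im a * (norm z / R\<^sup>2) \<le> 2 * Im a * (2 * norm z powr \<beta> / R powr (\<beta> + 1))"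
      using assms by (intro mult_left_mono) auto
    moreover have "Im z * (2 * Im a / R\<^sup>2) \<le> norm z * (2 * Im a / R\<^sup>2)"
      using assms by (intro mult_right_mono) (use abs_Im_le_cmod[of z] in auto)
    ultimately have "2 * Im z * Im a / R\<^sup>2 \<le> 4 * (Im a / R powr (\<beta> + 1)) * norm z powr \<beta>"
      by (simp add: mult_ac)
    then show ?thesis
      using norm_nevanlinna_factor_le[OF assms(1,2)] unfolding R_def[symmetric]
      by (meson exp_le_cancel_iff order_trans)
  qed
qed

lemma norm_nevanlinna_factor_half_height_le:
  assumes "x \<ge> 2"
  shows "norm (nevanlinna_factor (Complex x 1) (Complex x (1/2))) \<le> exp (- 1/2)"
proof -
  let ?a = "Complex x 1" and ?z = "Complex x (1/2)"
  have "norm (?z - ?a) / norm (?z - cnj ?a) = 1/3"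
    by (simp add: cmod_def)
  moreover have "?a \<noteq> 0"
    by (simp add: complex_eq_iff)
  ultimately have "norm (nevanlinna_factor ?a ?z) = exp (1 / (norm ?a)\<^sup>2) / 3"
    by (simp add: norm_nevanlinna_factor)
  also have "\<dots> \<le> exp (1/2) / exp 1"
  proof (intro frac_le)
    have "2 \<le> (norm ?a)\<^sup>2"
      using assms power_mono[of 2 x 2] by (simp add: cmod_power2)
    then have "1 / (norm ?a)\<^sup>2 \<le> 1/2"
      by (intro frac_le) auto
    then show "exp (1 / (norm ?a)\<^sup>2) \<le> exp (1/2)"
      by simp
  qed (use exp_le in auto)
  also have "\<dots> = exp (- 1/2)"
    by (simp add: exp_diff[symmetric])
  finally show ?thesis .
qed

section \<open>Canonical products in the half-plane\<close>

text \<open>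
  Zeros \<open>a k\<close> with multiplicities \<open>m k\<close> (possibly \<open>0\<close>). The lower bound \<open>1\<close> on \<open>Im (a k)\<close> keeps the poles
  \<open>cnj (a k)\<close> out of the half-plane \<open>Im z > -1\<close>, so that the product is holomorphic across the
  real axis.
\<close>

locale nevanlinna_product =
  fixes a :: "nat \<Rightarrow> complex" and m :: "nat \<Rightarrow> nat" and \<beta> :: real
  assumes Im_a: "\<And>k. Im (a k) \<ge> 1"
    and a_infinity: "filterlim a at_infinity sequentially"
    and \<beta>: "1 < \<beta>" "\<beta> < 2"
    and summable_weight: "summable (\<lambda>k. m k * (Im (a k) / norm (a k) powr (\<beta> + 1)))"
begin

text \<open>
  The contribution of the zero \<open>a k\<close>, with its multiplicity, to the product.
\<close>

definition factor :: "nat \<Rightarrow> complex \<Rightarrow> complex" where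
  "factor k z = nevanlinna_factor (a k) z ^ m k"

text \<open>
  The canonical product of genus one for the half-plane.
\<close>

definition product :: "complex \<Rightarrow> complex" where
  "product z = prodinf (\<lambda>k. factor k z)"

text \<open>
  The weight of the \<open>k\<close>-th zero: up to constants, the coefficient of \<open>\<bar>z\<bar> powr \<beta>\<close> in the bound on
  \<open>ln \<bar>factor k z\<bar>\<close>, and of \<open>R\<^sup>2\<close> in the bound on \<open>\<bar>factor k z - 1\<bar>\<close> for \<open>\<bar>z\<bar> \<le> R\<close>
  and \<open>k\<close> large depending on \<open>R\<close>.
\<close>

definition weight :: "nat \<Rightarrow> real" where
  "weight k = m k * (Im (a k) / norm (a k) powr (\<beta> + 1))"

text \<open>
  The sum of all weights; \<open>4 * total_weight\<close> bounds the type of the product in the closed half-plane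
  with respect to the order \<open>\<beta>\<close>.
\<close>

definition total_weight :: real where
  "total_weight = (\<Sum>k. weight k)"

lemma weight_nonneg: "weight k \<ge> 0"
  using Im_a[of k] by (simp add: weight_def)

lemma weight_summable: "summable weight"
  using summable_weight by (simp add: weight_def[abs_def])

lemma total_weight_nonneg: "total_weight \<ge> 0"
  unfolding total_weight_def by (intro suminf_nonneg weight_summable weight_nonneg)

lemma factor_minus_1_le:
  assumes "R > 0"
  shows "\<forall>\<^sub>F k in sequentially. \<forall>z\<in>cball 0 R. norm (factor k z - 1) \<le> 6 * R\<^sup>2 * weight k"
proof -
  have lim: "filterlim (\<lambda>k. norm (a k)) at_top sequentially"
    using a_infinity filterlim_at_infinity_imp_norm_at_top by blast
  have "(\<lambda>k. 4 * R\<^sup>2 * weight k) \<longlonglongrightarrow> 4 * R\<^sup>2 * 0"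
    by (intro tendsto_intros summable_LIMSEQ_zero weight_summable)
  then have small: "\<forall>\<^sub>F k in sequentially. 4 * R\<^sup>2 * weight k < 1/2"
    by (intro order_tendstoD(2)) auto
  have "\<forall>\<^sub>F k in sequentially. norm (a k) \<ge> max 1 (2 * R)"
    using lim by (simp only: filterlim_at_top)
  then show ?thesis
    using small
  proof eventually_elim
    case (elim k)
    show ?case
    proof
      fix z :: complex assume "z \<in> cball 0 R"
      then have z: "norm z \<le> R"
        by simp
      have "Im (a k) > 0" "norm z \<le> norm (a k) / 2"
        using Im_a[of k] elim z by auto
      then obtain L where L: "nevanlinna_factor (a k) z = exp L"
          "norm L \<le> 4 * Im (a k) * (norm z)\<^sup>2 / norm (a k) ^ 3"
        by (rule nevanlinna_factor_log)
      have "norm (of_nat (m k) * L) \<le> m k * (4 * Im (a k) * (norm z)\<^sup>2 / norm (a k) ^ 3)"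
        unfolding norm_mult norm_of_nat by (intro mult_left_mono L(2)) auto
      also have "\<dots> \<le> m k * (4 * Im (a k) * R\<^sup>2 / norm (a k) powr (\<beta> + 1))"
      proof (intro mult_left_mono frac_le mult_nonneg_nonneg power_mono)
        have "norm (a k) powr (\<beta> + 1) \<le> norm (a k) powr 3"
          using elim \<beta> by (intro powr_mono) auto
        then show "norm (a k) powr (\<beta> + 1) \<le> norm (a k) ^ 3"
          using elim by simp
        show "0 < norm (a k) powr (\<beta> + 1)"
          using elim by auto
      qed (use z Im_a[of k] in auto)
      also have "\<dots> = 4 * R\<^sup>2 * weight k"
        by (simp add: weight_def)
      finally have mL: "norm (of_nat (m k) * L) \<le> 4 * R\<^sup>2 * weight k" .
      have "factor k z = exp (of_nat (m k) * L)"
        by (simp add: factor_def L(1) exp_of_nat_mult)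
      then have "norm (factor k z - 1) \<le> 3 / 2 * norm (of_nat (m k) * L)"
        using norm_exp_bounds(2)[of "of_nat (m k) * L"] mL elim by simp
      then show "norm (factor k z - 1) \<le> 6 * R\<^sup>2 * weight k"
        using mL by linarith
    qed
  qed
qed

lemma factor_holomorphic: "factor k holomorphic_on {z. Im z > -1}"
  unfolding factor_def
  by (intro holomorphic_on_power holomorphic_on_subset[OF nevanlinna_factor_holomorphic])
    (use Im_a[of k] in auto)

lemma abs_convergent_factor: "abs_convergent_prod (\<lambda>k. factor k z)"
  unfolding abs_convergent_prod_conv_summable
proof (rule summable_comparison_test_ev)
  have "norm z + 1 > 0"
    by (intro add_nonneg_pos) auto
  then have "\<forall>\<^sub>F k in sequentially. \<forall>w\<in>cball 0 (norm z + 1). norm (factor k w - 1) \<le> 6 * (norm z + 1)\<^sup>2 * weight k"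
    by (rule factor_minus_1_le)
  then show "\<forall>\<^sub>F k in sequentially. norm (norm (factor k z - 1)) \<le> 6 * (norm z + 1)\<^sup>2 * weight k"
    by eventually_elim auto
  show "summable (\<lambda>k. 6 * (norm z + 1)\<^sup>2 * weight k)"
    by (intro summable_mult weight_summable)
qed

lemma has_prod_product: "(\<lambda>k. factor k z) has_prod product z"
  unfolding product_def
  by (intro convergent_prod_has_prod abs_convergent_prod_imp_convergent_prod abs_convergent_factor)

lemma product_LIMSEQ: "(\<lambda>N. \<Prod>k<N. factor k z) \<longlonglongrightarrow> product z"
  using has_prod_imp_tendsto'[OF has_prod_product] .

lemma product_holomorphic: "product holomorphic_on {z. Im z > -1}"
proof (rule holomorphic_uniform_sequence)
  show "open {z. Im z > -1}"
    by (rule open_halfspace_Im_gt)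
  show "(\<lambda>z. \<Prod>k<N. factor k z) holomorphic_on {z. Im z > -1}" for N
    by (intro holomorphic_on_prod factor_holomorphic)
  fix x assume "x \<in> {z. Im z > -1}"
  then obtain d where d: "d > 0" "cball x d \<subseteq> {z. Im z > -1}"
    using open_halfspace_Im_gt open_contains_cball by blast
  have "uniformly_convergent_on (cball x d) (\<lambda>N z. \<Prod>k<N. factor k z)"
  proof (rule uniformly_convergent_on_prod')
    show "continuous_on (cball x d) (factor k)" for k
      by (intro holomorphic_on_imp_continuous_on holomorphic_on_subset[OF factor_holomorphic] d)
    show "uniformly_convergent_on (cball x d) (\<lambda>N z. \<Sum>k<N. norm (factor k z - 1))"
    proof (rule Weierstrass_m_test'_ev)
      have pos: "norm x + d > 0"
        using d by (intro add_nonneg_pos) auto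
      have sub: "z \<in> cball 0 (norm x + d)" if "z \<in> cball x d" for z
        using that norm_triangle_ineq2[of z x] by (auto simp: dist_norm norm_minus_commute)
      show "\<forall>\<^sub>F k in sequentially. \<forall>z\<in>cball x d. norm (norm (factor k z - 1)) \<le> 6 * (norm x + d)\<^sup>2 * weight k"
        using factor_minus_1_le[OF pos] by eventually_elim (use sub in auto)
      show "summable (\<lambda>k. 6 * (norm x + d)\<^sup>2 * weight k)"
        by (intro summable_mult weight_summable)
    qed
  qed auto
  then obtain g where g: "uniform_limit (cball x d) (\<lambda>N z. \<Prod>k<N. factor k z) g sequentially"
    by (auto simp: uniformly_convergent_on_def)
  have "g z = product z" if "z \<in> cball x d" for z
    using tendsto_uniform_limitI[OF g that] product_LIMSEQ LIMSEQ_unique by blast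
  then have "uniform_limit (cball x d) (\<lambda>N z. \<Prod>k<N. factor k z) product sequentially"
    using g by (subst (asm) uniform_limit_cong') auto
  then show "\<exists>d>0. cball x d \<subseteq> {z. Im z > -1} \<and>
      uniform_limit (cball x d) (\<lambda>N z. \<Prod>k<N. factor k z) product sequentially"
    using d by blast
qed

lemma product_nonzero:
  assumes "Im z > -1" "z \<notin> range a"
  shows "product z \<noteq> 0"
proof -
  have "factor k z \<noteq> 0" for k
    using assms Im_a[of k] by (auto simp: factor_def nevanlinna_factor_eq_0_iff)
  then show ?thesis
    using has_prod_eq_0_iff[OF has_prod_product, of z] by fastforce
qed

lemma norm_product_real: "norm (product (of_real t)) = 1"
proof -
  have "Im (a k) \<noteq> 0" for k
    using Im_a[of k] by simp
  then have "norm (\<Prod>k<N. factor k (of_real t)) = 1" for N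
    by (simp add: factor_def norm_power norm_nevanlinna_factor_real prod_norm[symmetric])
  then show ?thesis
    using tendsto_norm[OF product_LIMSEQ[of "of_real t"]] by (simp add: LIMSEQ_const_iff)
qed

lemma norm_factor_le:
  assumes "Im z \<ge> 0"
  shows "norm (factor k z) \<le> exp (4 * weight k * norm z powr \<beta>)"
proof -
  have "norm (factor k z) \<le> exp (4 * (Im (a k) / norm (a k) powr (\<beta> + 1)) * norm z powr \<beta>) ^ m k"
    unfolding factor_def norm_power
    by (intro power_mono norm_nevanlinna_factor_le_powr) (use assms \<beta> Im_a[of k] in auto)
  then show ?thesis
    by (simp add: weight_def exp_of_nat_mult[symmetric] mult_ac)
qed

lemma norm_prod_factor_le:
  assumes "Im z \<ge> 0" "finite A"
  shows "norm (\<Prod>k\<in>A. factor k z) \<le> exp (4 * total_weight * norm z powr \<beta>)"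
proof -
  have "norm (\<Prod>k\<in>A. factor k z) \<le> (\<Prod>k\<in>A. exp (4 * weight k * norm z powr \<beta>))"
    unfolding prod_norm[symmetric] by (intro prod_mono conjI norm_factor_le assms) auto
  also have "\<dots> = exp (4 * (\<Sum>k\<in>A. weight k) * norm z powr \<beta>)"
    using assms by (simp add: exp_sum[symmetric] sum_distrib_left sum_distrib_right)
  also have "\<dots> \<le> exp (4 * total_weight * norm z powr \<beta>)"
    unfolding total_weight_def using assms
    by (subst exp_le_cancel_iff, intro mult_right_mono mult_left_mono sum_le_suminf
        weight_summable weight_nonneg) auto
  finally show ?thesis .
qed

lemma norm_product_le:
  assumes "Im z \<ge> 0"
  shows "norm (product z) \<le> exp (4 * total_weight * norm z powr \<beta>)"
  by (rule LIMSEQ_le_const2[OF tendsto_norm[OF product_LIMSEQ]])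
    (use norm_prod_factor_le[OF assms] in auto)

text \<open>
  The factor of one zero is kept, and only the remaining ones are estimated by their growth.
\<close>

lemma norm_product_le_factor:
  assumes "Im z \<ge> 0"
  shows "norm (product z) \<le> norm (factor j z) * exp (4 * total_weight * norm z powr \<beta>)"
proof (rule LIMSEQ_le_const2[OF tendsto_norm[OF product_LIMSEQ]], intro exI allI impI)
  fix N assume "N \<ge> Suc j"
  then have "norm (\<Prod>k<N. factor k z) = norm (factor j z) * norm (\<Prod>k\<in>{..<N} - {j}. factor k z)"
    by (subst prod.remove[of _ j]) (auto simp: norm_mult)
  also have "\<dots> \<le> norm (factor j z) * exp (4 * total_weight * norm z powr \<beta>)"
    by (intro mult_left_mono norm_prod_factor_le assms) auto
  finally show "norm (\<Prod>k<N. factor k z) \<le> norm (factor j z) * exp (4 * total_weight * norm z powr \<beta>)" .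
qed

end

section \<open>A function with deep minima on a horizontal line\<close>

lemma exists_sparse_sequence:
  fixes \<rho> :: "real \<Rightarrow> real"
  assumes "(\<rho> \<longlongrightarrow> 0) at_top"
  obtains x :: "nat \<Rightarrow> real" where "\<And>k. \<rho> (x k) \<le> (1/2) ^ k" "\<And>k. x k \<ge> 2" "\<And>k. x k \<ge> 4 ^ k"
proof -
  have "\<exists>t. \<rho> t \<le> (1/2) ^ k \<and> t \<ge> 2 \<and> t \<ge> 4 ^ k" for k
  proof -
    have "\<forall>\<^sub>F t in at_top. \<rho> t < (1/2) ^ k"
      using assms by (rule order_tendstoD) simp
    then have "\<forall>\<^sub>F t in at_top. \<rho> t < (1/2) ^ k \<and> t \<ge> max 2 (4 ^ k)"
      using eventually_ge_at_top by (rule eventually_conj)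
    then obtain t where "\<rho> t < (1/2) ^ k \<and> t \<ge> max 2 (4 ^ k)"
      using eventually_happens'[OF trivial_limit_at_top_linorder] by blast
    then show ?thesis
      by (intro exI[of _ t]) auto
  qed
  then show ?thesis
    using that by metis
qed

text \<open>
  The function \<open>F\<close>, defined slightly beyond the closed half-plane. The additive constant \<open>D\<close> in the
  last clause makes room for the bounded correction by which \<open>ln \<bar>f\<bar>\<close> may exceed \<open>ln \<bar>F\<bar>\<close>.
\<close>

lemma exists_small_on_line:
  fixes \<beta> :: real and \<rho> :: "real \<Rightarrow> real"
  assumes \<beta>: "1 < \<beta>" "\<beta> < 2"
    and \<rho>_pos: "\<And>x. x > 0 \<Longrightarrow> \<rho> x > 0"
    and \<rho>_lim: "(\<rho> \<longlongrightarrow> 0) at_top"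
  obtains F C where "C > 0" "F holomorphic_on {z. Im z > -1}"
    "\<And>z. \<lbrakk>-1 < Im z; Im z < 1\<rbrakk> \<Longrightarrow> F z \<noteq> 0"
    "\<And>z. Im z \<ge> 0 \<Longrightarrow> norm (F z) \<le> exp (C * norm z powr \<beta>)"
    "\<And>t. norm (F (of_real t)) = 1"
    "\<And>D. \<exists>\<^sub>F x in at_top. ln (norm (F (Complex x (1/2)))) + D \<le> - 1/2 * (\<rho> x * x powr (\<beta> + 1))"
proof -
  obtain x :: "nat \<Rightarrow> real" where \<rho>_x: "\<And>k. \<rho> (x k) \<le> (1/2) ^ k"
    and x2: "\<And>k. x k \<ge> 2" and x4: "\<And>k. x k \<ge> 4 ^ k"
    using exists_sparse_sequence[OF \<rho>_lim] by blast
  \<comment> \<open>The summand \<open>1 / sqrt (x k)\<close> prevents \<open>m k\<close> from being too small: it makes \<open>m k\<close> large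
    compared with \<open>x k powr \<beta>\<close>, whatever the decay of \<open>\<rho>\<close>.\<close>
  define \<tau> where "\<tau> k = \<rho> (x k) + 1 / sqrt (x k)" for k
  define m where "m k = nat \<lceil>\<tau> k * x k powr (\<beta> + 1)\<rceil>" for k
  define a where "a k = Complex (x k) 1" for k
  have sqrt_x: "sqrt (x k) \<ge> 2 ^ k" for k
    using real_sqrt_le_mono[OF x4[of k]] by (simp add: real_sqrt_power)
  have x_pos: "x k > 0" for k
    using x2[of k] by simp
  have \<tau>_le: "\<tau> k \<le> 2 * (1/2) ^ k" for k
  proof -
    have "1 / sqrt (x k) \<le> 1 / 2 ^ k"
      using sqrt_x[of k] by (intro frac_le) auto
    then show ?thesis
      using \<rho>_x[of k] by (simp add: \<tau>_def power_one_over)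
  qed
  have m_ge: "\<tau> k * x k powr (\<beta> + 1) \<le> m k" for k
    unfolding m_def by linarith
  have m_le: "m k \<le> 4 * (1/2) ^ k * x k powr (\<beta> + 1)" for k
  proof -
    have "x k powr (1/2) \<le> x k powr (\<beta> + 1)"
      using x2[of k] \<beta> by (intro powr_mono) auto
    then have "1 \<le> 1 / sqrt (x k) * x k powr (\<beta> + 1)"
      using x_pos[of k] by (simp add: powr_half_sqrt)
    also have "\<dots> \<le> \<tau> k * x k powr (\<beta> + 1)"
      using \<rho>_pos[OF x_pos[of k]] by (intro mult_right_mono) (auto simp: \<tau>_def)
    finally have "m k \<le> 2 * (\<tau> k * x k powr (\<beta> + 1))"
      unfolding m_def by linarith
    also have "\<dots> \<le> 2 * (2 * (1/2) ^ k * x k powr (\<beta> + 1))"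
      by (intro mult_left_mono mult_right_mono \<tau>_le) auto
    finally show ?thesis
      by simp
  qed
  have norm_a: "norm (a k) \<ge> x k" for k
    using complex_Re_le_cmod[of "a k"] by (simp add: a_def)
  have x_lim: "filterlim x at_top sequentially"
  proof (rule filterlim_at_top_mono)
    show "filterlim (\<lambda>k. 4 ^ k :: real) at_top sequentially"
      by real_asymp
  qed (use x4 in auto)
  interpret nevanlinna_product a m \<beta>
  proof
    show "Im (a k) \<ge> 1" for k
      by (simp add: a_def)
    have "filterlim (\<lambda>k. norm (a k)) at_top sequentially"
      using x_lim by (rule filterlim_at_top_mono) (use norm_a in auto)
    then show "filterlim a at_infinity sequentially"
      by (rule filterlim_norm_at_top_imp_at_infinity)
    show "summable (\<lambda>k. m k * (Im (a k) / norm (a k) powr (\<beta> + 1)))"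
    proof (rule summable_comparison_test')
      show "summable (\<lambda>k. 4 * (1/2 :: real) ^ k)"
        by (intro summable_mult summable_geometric) auto
      fix k
      have "m k \<le> 4 * (1/2) ^ k * norm (a k) powr (\<beta> + 1)"
        using m_le[of k] \<beta> x_pos[of k] norm_a[of k]
        by (elim order_trans) (intro mult_left_mono powr_mono2, auto)
      moreover have "norm (a k) powr (\<beta> + 1) > 0"
        using x_pos[of k] norm_a[of k] by auto
      ultimately show "norm (m k * (Im (a k) / norm (a k) powr (\<beta> + 1))) \<le> 4 * (1/2) ^ k"
        by (simp add: a_def divide_simps)
    qed
  qed (use \<beta> in auto)
  let ?S = total_weight
  have ln_le: "ln (norm (product (Complex (x k) (1/2)))) \<le> - real (m k) / 2 + 16 * ?S * x k powr \<beta>" for k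
  proof -
    define z where "z = Complex (x k) (1/2)"
    have Im_z: "Im z = 1/2"
      by (simp add: z_def)
    have "norm (factor k z) \<le> exp (- 1/2) ^ m k"
      unfolding factor_def norm_power a_def z_def
      by (intro power_mono norm_nevanlinna_factor_half_height_le x2) auto
    then have fac: "norm (factor k z) \<le> exp (- real (m k) / 2)"
      by (simp add: exp_of_nat_mult[symmetric])
    have "norm z \<le> 2 * x k"
      using cmod_le[of z] x2[of k] by (simp add: z_def)
    then have "norm z powr \<beta> \<le> (2 * x k) powr \<beta>"
      using \<beta> by (intro powr_mono2) auto
    also have "\<dots> = 2 powr \<beta> * x k powr \<beta>"
      using x_pos[of k] by (simp add: powr_mult)
    also have "\<dots> \<le> 2 powr 2 * x k powr \<beta>"
      using \<beta> by (intro mult_right_mono powr_mono) auto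
    finally have "4 * ?S * norm z powr \<beta> \<le> 4 * ?S * (4 * x k powr \<beta>)"
      using total_weight_nonneg by (intro mult_left_mono) auto
    then have "norm (factor k z) * exp (4 * ?S * norm z powr \<beta>)
        \<le> exp (- real (m k) / 2) * exp (16 * ?S * x k powr \<beta>)"
      using fac by (intro mult_mono) auto
    then have "norm (product z) \<le> exp (- real (m k) / 2) * exp (16 * ?S * x k powr \<beta>)"
      using norm_product_le_factor[of z k] Im_z by simp
    moreover have "product z \<noteq> 0"
      using Im_z by (intro product_nonzero) (auto simp: a_def)
    ultimately have "ln (norm (product z)) \<le> ln (exp (- real (m k) / 2 + 16 * ?S * x k powr \<beta>))"
      unfolding exp_add by (subst ln_le_cancel_iff) auto
    then show ?thesis
      by (simp add: z_def)
  qed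
  have freq: "\<exists>\<^sub>F t in at_top. ln (norm (product (Complex t (1/2)))) + D \<le> - 1/2 * (\<rho> t * t powr (\<beta> + 1))"
    (is "\<exists>\<^sub>F t in at_top. ?P t") for D
  proof -
    have "filterlim (\<lambda>k. sqrt (x k)) at_top sequentially"
      by (intro filterlim_compose[OF sqrt_at_top x_lim])
    then have "\<forall>\<^sub>F k in sequentially. sqrt (x k) \<ge> 2 * (16 * ?S + \<bar>D\<bar>)"
      by (simp only: filterlim_at_top)
    then have ev: "\<forall>\<^sub>F k in sequentially. ?P (x k)"
    proof eventually_elim
      case (elim k)
      define T where "T = x k powr (\<beta> + 1)"
      have "1 \<le> x k powr \<beta>"
        using x2[of k] \<beta> by (intro ge_one_powr_ge_zero) auto
      then have "\<bar>D\<bar> * 1 \<le> \<bar>D\<bar> * x k powr \<beta>"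
        by (intro mult_left_mono) auto
      then have "16 * ?S * x k powr \<beta> + D \<le> (16 * ?S + \<bar>D\<bar>) * x k powr \<beta>"
        by (simp add: algebra_simps)
      also have "\<dots> \<le> (sqrt (x k) / 2) * x k powr \<beta>"
        using elim by (intro mult_right_mono) auto
      also have "\<dots> = T / sqrt (x k) / 2"
        using x_pos[of k] by (simp add: T_def powr_add field_simps)
      finally have "16 * ?S * x k powr \<beta> + D \<le> T / sqrt (x k) / 2" .
      moreover have "\<rho> (x k) * T + T / sqrt (x k) \<le> m k"
        using m_ge[of k] by (simp add: T_def \<tau>_def algebra_simps)
      ultimately show ?case
        using ln_le[of k] by (simp add: T_def)
    qed
    show ?thesis
      unfolding frequently_def
    proof
      assume "\<forall>\<^sub>F t in at_top. \<not> ?P t"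
      then have "\<forall>\<^sub>F k in sequentially. \<not> ?P (x k)"
        using x_lim by (rule eventually_compose_filterlim)
      with ev have "\<forall>\<^sub>F k in sequentially. False"
        by eventually_elim auto
      then show False
        by simp
    qed
  qed
  show ?thesis
  proof (rule that[of "4 * ?S + 1" product])
    show "4 * ?S + 1 > 0"
      using total_weight_nonneg by linarith
    show "product z \<noteq> 0" if "-1 < Im z" "Im z < 1" for z
      using that by (intro product_nonzero) (auto simp: a_def)
    show "norm (product z) \<le> exp ((4 * ?S + 1) * norm z powr \<beta>)" if "Im z \<ge> 0" for z
      using norm_product_le[OF that] by (elim order_trans) (auto simp: algebra_simps)
  qed (fact product_holomorphic norm_product_real freq)+
qed

section \<open>Real parts of powers in the right half-plane\<close>

lemma Re_powr_le_right_half_plane: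
  fixes \<beta> :: real
  assumes "1 < \<beta>" "\<beta> < 2"
  obtains \<kappa> B where "\<kappa> > 0" "B > 0"
    "\<And>w. Re w \<ge> 0 \<Longrightarrow> Re (w powr of_real \<beta>) \<le> B * Re w powr \<beta> - \<kappa> * norm w powr \<beta>"
proof -
  \<comment> \<open>Any \<open>\<theta>\<close> strictly between \<open>pi / (2 * \<beta>)\<close> and \<open>pi / 2\<close> will do: \<open>cos (\<beta> * t)\<close> is negative
    for \<open>\<theta> \<le> t \<le> pi / 2\<close>, and \<open>cos t\<close> is bounded away from \<open>0\<close> for \<open>0 \<le> t \<le> \<theta>\<close>.\<close>
  define \<theta> where "\<theta> = (pi / (2 * \<beta>) + pi / 2) / 2"
  have th: "pi / 2 < \<beta> * \<theta>" "\<theta> < pi / 2" "0 < \<theta>"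
    using assms by (auto simp: \<theta>_def field_simps intro!: add_pos_pos)
  have bpi: "\<beta> * (pi / 2) < pi"
    using assms by simp
  define \<kappa> where "\<kappa> = - cos (\<beta> * \<theta>)"
  define B where "B = (1 + \<kappa>) / cos \<theta> powr \<beta>"
  have "\<beta> * \<theta> < pi"
    using mult_strict_left_mono[OF th(2), of \<beta>] assms bpi by linarith
  then have "cos (\<beta> * \<theta>) < cos (pi / 2)"
    using th by (intro cos_monotone_0_pi) auto
  then have k: "\<kappa> > 0"
    by (simp add: \<kappa>_def)
  have cos_th: "cos \<theta> > 0"
    using th by (intro cos_gt_zero) auto
  have B: "B > 0"
    using k cos_th by (simp add: B_def)
  show ?thesis
  proof (rule that[OF k B])
    fix w :: complex assume w: "Re w \<ge> 0"
    show "Re (w powr of_real \<beta>) \<le> B * Re w powr \<beta> - \<kappa> * norm w powr \<beta>"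
    proof (cases "w = 0")
      case False
      define t where "t = \<bar>Arg w\<bar>"
      have t: "0 \<le> t" "t \<le> pi / 2"
        using w Arg_Re_nonneg[of w] by (auto simp: t_def)
      have Re_w: "Re w = norm w * cos t"
        using cos_Arg[OF False] False by (auto simp: t_def)
      have "Re (w powr of_real \<beta>) = norm w powr \<beta> * cos (\<beta> * Arg w)"
        using False by (simp add: powr_def Ln_Arg Re_exp algebra_simps)
      also have "cos (\<beta> * Arg w) = cos (\<beta> * t)"
        by (auto simp: t_def abs_if)
      also have "cos (\<beta> * t) \<le> B * cos t powr \<beta> - \<kappa>"
      proof (cases "t \<ge> \<theta>")
        case True
        have "\<beta> * t \<le> \<beta> * (pi / 2)"
          using t assms by (intro mult_left_mono) auto
        then have "\<beta> * t \<le> pi"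
          using bpi by linarith
        then have "cos (\<beta> * t) \<le> cos (\<beta> * \<theta>)"
          using True th assms by (intro cos_monotone_0_pi_le) auto
        moreover have "B * cos t powr \<beta> \<ge> 0"
          using B by simp
        ultimately show ?thesis
          by (simp add: \<kappa>_def)
      next
        case False
        then have "cos \<theta> \<le> cos t"
          using t th by (intro cos_monotone_0_pi_le) auto
        then have "B * cos \<theta> powr \<beta> \<le> B * cos t powr \<beta>"
          using B cos_th assms by (intro mult_left_mono powr_mono2) auto
        moreover have "B * cos \<theta> powr \<beta> = 1 + \<kappa>"
          using cos_th by (simp add: B_def)
        ultimately show ?thesis
          using cos_le_one[of "\<beta> * t"] by linarith
      qed
      then have "norm w powr \<beta> * cos (\<beta> * t) \<le> norm w powr \<beta> * (B * cos t powr \<beta> - \<kappa>)"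
        by (intro mult_left_mono) auto
      also have "\<dots> = B * Re w powr \<beta> - \<kappa> * norm w powr \<beta>"
        using t cos_ge_zero[of t] by (simp add: Re_w powr_mult algebra_simps)
      finally show ?thesis .
    qed auto
  qed
qed

section \<open>The two functions\<close>

lemma Liminf_le_frequently:
  fixes g :: "'a \<Rightarrow> 'b :: complete_linorder"
  assumes "\<exists>\<^sub>F x in F. g x \<le> l"
  shows "Liminf F g \<le> l"
proof (rule Liminf_least)
  fix P assume "eventually P F"
  with assms have "\<exists>\<^sub>F x in F. g x \<le> l \<and> P x"
    by (rule frequently_eventually_frequently)
  then obtain x where "P x" "g x \<le> l"
    by (auto dest: frequently_ex)
  then show "(INF x\<in>Collect P. g x) \<le> l"
    by (meson INF_lower2 mem_Collect_eq)
qed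

theorem proposition2p5:
  fixes \<beta> :: real and \<rho> :: "real \<Rightarrow> real"
  assumes "1 < \<beta>" and "\<beta> < 2"
    and "\<And>x. x > 0 \<Longrightarrow> \<rho> x > 0"
    and "(\<rho> \<longlongrightarrow> 0) at_top"
  shows "\<exists>(f :: complex \<Rightarrow> complex) (F :: complex \<Rightarrow> complex) (c :: real) (C :: real).
    c > 0 \<and> C > 0 \<and>
    f holomorphic_on upper_half_plane \<and> continuous_on closed_upper_half_plane f \<and>
    F holomorphic_on upper_half_plane \<and> continuous_on closed_upper_half_plane F \<and>
    (\<forall>x y :: real. 0 < y \<and> y < 1 \<longrightarrow> f (Complex x y) \<noteq> 0 \<and> F (Complex x y) \<noteq> 0) \<and>
    (\<forall>x y :: real. 0 \<le> y \<longrightarrow> cmod (f (Complex x y)) \<le> c * exp (C * y powr \<beta>)) \<and>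
    (\<forall>z \<in> closed_upper_half_plane. cmod (F z) \<le> c * exp (C * cmod z powr \<beta>)) \<and>
    (\<forall>x :: real. cmod (F (complex_of_real x)) = 1) \<and>
    Liminf at_top (\<lambda>x :: real. ereal (ln (cmod (f (Complex x (1/2)))) / (\<rho> x * x powr (\<beta> + 1)))) < 0 \<and>
    Liminf at_top (\<lambda>x :: real. ereal (ln (cmod (F (Complex x (1/2)))) / (\<rho> x * x powr (\<beta> + 1)))) < 0"
proof -
  obtain F C where C: "C > 0" and hol_F: "F holomorphic_on {z. Im z > -1}"
    and F_nz: "\<And>z. \<lbrakk>-1 < Im z; Im z < 1\<rbrakk> \<Longrightarrow> F z \<noteq> 0"
    and F_le: "\<And>z. Im z \<ge> 0 \<Longrightarrow> norm (F z) \<le> exp (C * norm z powr \<beta>)"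
    and F_real: "\<And>t. norm (F (of_real t)) = 1"
    and F_small: "\<And>D. \<exists>\<^sub>F x in at_top.
      ln (norm (F (Complex x (1/2)))) + D \<le> - 1/2 * (\<rho> x * x powr (\<beta> + 1))"
    by (rule exists_small_on_line[OF assms]) (assumption | rule that)+
  obtain \<kappa> B where \<kappa>: "\<kappa> > 0" and B: "B > 0" and powr_le:
    "\<And>w. Re w \<ge> 0 \<Longrightarrow> Re (w powr of_real \<beta>) \<le> B * Re w powr \<beta> - \<kappa> * norm w powr \<beta>"
    by (rule Re_powr_le_right_half_plane[OF assms(1,2)]) (rule that)
  \<comment> \<open>The constant \<open>C / \<kappa>\<close> is chosen so that the term \<open>- \<kappa> * norm w powr \<beta>\<close> cancels the growth
    \<open>C * norm z powr \<beta>\<close> of \<open>ln (norm (F z))\<close>.\<close>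
  define G where "G z = exp (of_real (C / \<kappa>) * (- \<i> * z) powr of_real \<beta>)" for z
  define f where "f z = F z * G z" for z
  let ?M = "C / \<kappa> * B"
  have M: "?M > 0"
    using C \<kappa> B by simp
  have norm_G: "norm (G z) \<le> exp (?M * Im z powr \<beta> - C * norm z powr \<beta>)" if "Im z \<ge> 0" for z
  proof -
    have "C / \<kappa> * Re ((- \<i> * z) powr of_real \<beta>) \<le> C / \<kappa> * (B * Im z powr \<beta> - \<kappa> * norm z powr \<beta>)"
      using powr_le[of "- \<i> * z"] that C \<kappa> by (intro mult_left_mono) (auto simp: norm_mult)
    then show ?thesis
      using \<kappa> by (simp add: G_def algebra_simps)
  qed
  have hol_G: "G holomorphic_on upper_half_plane"
    unfolding G_def upper_half_plane_def
    by (intro holomorphic_intros) (auto simp: complex_nonpos_Reals_iff)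
  have cont_G: "continuous_on closed_upper_half_plane G"
    unfolding G_def closed_upper_half_plane_def using assms(1)
    by (intro continuous_intros continuous_on_powr_complex) (auto simp: complex_nonpos_Reals_iff)
  have hol_F': "F holomorphic_on upper_half_plane"
    using hol_F by (rule holomorphic_on_subset) (auto simp: upper_half_plane_def)
  have cont_F: "continuous_on closed_upper_half_plane F"
    using holomorphic_on_imp_continuous_on[OF hol_F]
    by (rule continuous_on_subset) (auto simp: closed_upper_half_plane_def)
  have Liminf_neg: "Liminf at_top (\<lambda>x. ereal (h x / (\<rho> x * x powr (\<beta> + 1)))) < 0"
    if "\<And>x. h x \<le> ln (norm (F (Complex x (1/2)))) + D" for h :: "real \<Rightarrow> real" and D
  proof -
    have "\<exists>\<^sub>F x in at_top. ereal (h x / (\<rho> x * x powr (\<beta> + 1))) \<le> ereal (- 1/2)"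
      using frequently_eventually_frequently[OF F_small[of D] eventually_gt_at_top[of 0]]
    proof (rule frequently_elim1)
      fix x :: real
      assume x: "ln (norm (F (Complex x (1/2)))) + D \<le> - 1/2 * (\<rho> x * x powr (\<beta> + 1)) \<and> 0 < x"
      then have "\<rho> x * x powr (\<beta> + 1) > 0"
        using assms(3) by simp
      then show "ereal (h x / (\<rho> x * x powr (\<beta> + 1))) \<le> ereal (- 1/2)"
        using x that[of x] by (simp add: pos_divide_le_eq)
    qed
    then have "Liminf at_top (\<lambda>x. ereal (h x / (\<rho> x * x powr (\<beta> + 1)))) \<le> ereal (- 1/2)"
      by (rule Liminf_le_frequently)
    also have "\<dots> < 0"
      by simp
    finally show ?thesis .
  qed
  have ln_f: "ln (norm (f (Complex x (1/2)))) \<le> ln (norm (F (Complex x (1/2)))) + ?M * (1/2) powr \<beta>" for x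
  proof -
    let ?z = "Complex x (1/2)"
    have "ln (norm (f ?z)) = ln (norm (F ?z)) + ln (norm (G ?z))"
      using F_nz[of ?z] by (simp add: f_def G_def norm_mult ln_mult)
    moreover have "ln (norm (G ?z)) \<le> ?M * (1/2) powr \<beta> - C * norm ?z powr \<beta>"
      using norm_G[of ?z] by (simp add: G_def)
    moreover have "C * norm ?z powr \<beta> \<ge> 0"
      using C by simp
    ultimately show ?thesis
      by linarith
  qed
  have f_le: "norm (f z) \<le> exp (?M * Im z powr \<beta>)" if "Im z \<ge> 0" for z
  proof -
    have "norm (f z) \<le> exp (C * norm z powr \<beta>) * exp (?M * Im z powr \<beta> - C * norm z powr \<beta>)"
      unfolding f_def norm_mult by (intro mult_mono F_le norm_G that) auto
    then show ?thesis
      by (simp add: exp_add[symmetric])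
  qed
  have exp_mono: "exp (M * s powr \<beta>) \<le> exp ((C + ?M) * s powr \<beta>)" if "M \<le> C + ?M" for M s
    using that by (auto intro: mult_right_mono)
  show ?thesis
  proof (rule exI[of _ f], rule exI[of _ F], rule exI[of _ 1], rule exI[of _ "C + ?M"],
      intro conjI allI ballI impI)
    show "f holomorphic_on upper_half_plane" "continuous_on closed_upper_half_plane f"
      unfolding f_def by (intro holomorphic_intros continuous_intros hol_F' hol_G cont_F cont_G)+
    show "f (Complex x y) \<noteq> 0" "F (Complex x y) \<noteq> 0" if "0 < y \<and> y < 1" for x y
      using that F_nz[of "Complex x y"] by (auto simp: f_def G_def)
    show "cmod (f (Complex x y)) \<le> 1 * exp ((C + ?M) * y powr \<beta>)" if "0 \<le> y" for x y
    proof -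
      have "cmod (f (Complex x y)) \<le> exp (?M * y powr \<beta>)"
        using f_le[of "Complex x y"] that by simp
      also have "\<dots> \<le> exp ((C + ?M) * y powr \<beta>)"
        by (rule exp_mono) (use C in simp)
      finally show ?thesis
        by simp
    qed
    show "cmod (F z) \<le> 1 * exp ((C + ?M) * cmod z powr \<beta>)" if "z \<in> closed_upper_half_plane" for z
    proof -
      have "cmod (F z) \<le> exp (C * cmod z powr \<beta>)"
        using F_le[of z] that by (simp add: closed_upper_half_plane_def)
      also have "\<dots> \<le> exp ((C + ?M) * cmod z powr \<beta>)"
        by (rule exp_mono) (use M in simp)
      finally show ?thesis
        by simp
    qed
    show "C + ?M > 0"
      using C M by simp
    show "Liminf at_top (\<lambda>x. ereal (ln (cmod (F (Complex x (1/2)))) / (\<rho> x * x powr (\<beta> + 1)))) < 0"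
      by (rule Liminf_neg[of _ 0]) simp
    show "Liminf at_top (\<lambda>x. ereal (ln (cmod (f (Complex x (1/2)))) / (\<rho> x * x powr (\<beta> + 1)))) < 0"
      by (rule Liminf_neg) (rule ln_f)
  qed (simp_all add: hol_F' cont_F F_real)
qed

end
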